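(* The following two statements are equivalent. (a) (Tomaszewski's conjecture) For every $n\in\mathbb{N}$ and every $a\in\mathbb{R}^n$, $P(|a\cdot\epsilon|\le\|a\|)\ge\frac12$. (b) For every $n\in\mathbb{N}$ and every $a=(a_1,\dots,a_n)\in\mathbb{R}^n$ with $\|a\|=1$, the $2^n$ sign sums of the form $S=\pm a_1\pm\cdots\pm a_n$ can be partitioned into $2^{n-1}$ pairs $\{(s_1^j,s_2^j): j=1,\dots,2^{n-1}\}$ such that $|s_1^j|\cdot|s_2^j|\le 1$ for all $j=1,\dots,2^{n-1}$.
   Context: $\mathbb{N}=\{1,2,\dots\}$. $\epsilon=(\epsilon_1,\dots,\epsilon_n)$, where $\epsilon_1,\dots,\epsilon_n$ are independent random variables with $P(\epsilon_i=1)=P(\epsilon_i=-1)=\frac12$. For $a=(a_1,\dots,a_n)\in\mathbb{R}^n$, $a\cdot\epsilon=a_1\epsilon_1+\cdots+a_n\epsilon_n$ and $\|a\|=(\sum_{i=1}^n a_i^2)^{1/2}$. The $2^n$ sign sums are counted with multiplicity, one for each sign vector in $\{-1,1\}^n$ (so the partition is a partition of the $2^n$ sign vectors into pairs). *)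

theory Defs
  imports "HOL-Probability.Probability" "HOL-Probability.Product_PMF"
begin

text \<open>
  The dimension is quantified inside the statement, so a vector \<open>a\<close> in n-dimensional real space is
  a function \<open>a :: nat \<Rightarrow> real\<close> of which only the values at \<open>1, \<dots>, n\<close> matter; its Euclidean norm is
  \<^term>\<open>L2_set a {1..n}\<close>.
\<close>

definition dotn :: "nat \<Rightarrow> (nat \<Rightarrow> real) \<Rightarrow> (nat \<Rightarrow> real) \<Rightarrow> real"
  where "dotn n a e = (\<Sum>i = 1..n. a i * e i)"

text \<open>Extensional functions, so that there are exactly \<open>2 ^ n\<close> sign vectors.\<close>

definition sign_vectors :: "nat \<Rightarrow> (nat \<Rightarrow> real) set"
  where "sign_vectors n = {1..n} \<rightarrow>\<^sub>E {- 1, 1}"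

text \<open>
  The joint law of \<open>n\<close> independent random signs, a product of uniform distributions on \<open>{- 1, 1}\<close>.
  The default value \<^const>\<open>undefined\<close> outside the index set makes its support \<open>sign_vectors n\<close>.
\<close>

definition sign_pmf :: "nat \<Rightarrow> (nat \<Rightarrow> real) pmf"
  where "sign_pmf n = Pi_pmf {1..n} undefined (\<lambda>_. pmf_of_set {- 1, 1})"

text \<open>
  Pairs of sign vectors rather than of values: sign sums are counted with multiplicity, and
  distinct sign vectors may have equal sums.
\<close>

definition is_pairing :: "'a set \<Rightarrow> 'a set set \<Rightarrow> bool"
  where "is_pairing A \<P> \<longleftrightarrow> partition_on A \<P> \<and> (\<forall>B\<in>\<P>. card B = 2)"

lemma card_sign_vectors: "card (sign_vectors n) = 2 ^ n"
  by (simp add: sign_vectors_def card_PiE numeral_2_eq_2)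

lemma set_sign_pmf: "set_pmf (sign_pmf n) = sign_vectors n"
  by (auto simp: sign_pmf_def sign_vectors_def set_Pi_pmf PiE_dflt_def PiE_def Pi_def
      extensional_def)

lemma sign_pmf_marginal:
  assumes "i \<in> {1..n}"
  shows "map_pmf (\<lambda>e. e i) (sign_pmf n) = pmf_of_set {- 1, 1}"
  using assms by (simp add: sign_pmf_def Pi_pmf_component)

lemma indep_vars_sign_pmf:
  "prob_space.indep_vars (measure_pmf (sign_pmf n)) (\<lambda>_. count_space UNIV) (\<lambda>i e. e i) {1..n}"
  by (simp add: sign_pmf_def indep_vars_Pi_pmf)

end

theory Submission
  imports Defs
begin

text \<open>
  Write \<open>S e\<close> for the sign sum \<open>dotn n a e\<close>. The random sign vector is uniform on the \<open>2 ^ n\<close> sign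
  vectors, so both statements are about counting, and they are linked by a tail condition: for
  every \<open>t \<ge> 1\<close> at least as many sign vectors satisfy \<open>\<bar>S e\<bar> \<le> 1 / t\<close> as satisfy \<open>\<bar>S e\<bar> > t\<close>.

  A pairing as in (b) gives (a) at once after normalising \<open>a\<close>: two numbers with product at most
  \<open>1\<close> cannot both exceed \<open>1\<close>, so every pair contains a sign vector with \<open>\<bar>S e\<bar> \<le> 1\<close>
  (\<open>card_le_pairing\<close>).

  Conversely, (a) yields the tail condition in dimension \<open>n\<close> when it is applied in dimension
  \<open>n + 1\<close>, to the unit vector \<open>a\<close> extended by the coordinate \<open>b = (t - 1 / t) / 2\<close>
  (\<open>tail_balance_of_half\<close>). The new norm is \<open>c = sqrt (1 + b\<^sup>2) = (t + 1 / t) / 2\<close>, so \<open>c + b = t\<close>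
  and \<open>c - b = 1 / t\<close>. The two values of the additional sign thus ask for \<open>S e\<close> in \<open>[- t, 1 / t]\<close>
  and in \<open>[- 1 / t, t]\<close>; together these two intervals count \<open>[- t, t]\<close> once and
  \<open>[- 1 / t, 1 / t]\<close> once more. Statement (a) says that the total is at least \<open>2 ^ n\<close>, and
  \<open>2 ^ n\<close> minus the first count is the number of \<open>e\<close> with \<open>\<bar>S e\<bar> > t\<close>, so this is the tail condition.
  The tail condition in turn allows the vector with the largest sum in absolute
  value to be matched with the one with the smallest, then the second largest with the second
  smallest, and so on (\<open>pairing_of_tail_balance\<close>).
\<close>

section \<open>Pairings with small products\<close>

lemma is_pairing_insert:
  assumes "is_pairing (A - {x, y}) \<P>" "x \<in> A" "y \<in> A" "x \<noteq> y"
  shows "is_pairing A (insert {x, y} \<P>)"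
proof -
  have "\<Union> \<P> = A - {x, y}" "disjoint \<P>" "{} \<notin> \<P>"
    using assms by (auto simp: is_pairing_def partition_on_def)
  then have "partition_on A (insert {x, y} \<P>)"
    using assms(2,3) by (intro partition_onI) (auto simp: disjnt_def disjoint_def)
  then show ?thesis
    using assms by (auto simp: is_pairing_def)
qed

lemma card_is_pairing:
  assumes "is_pairing A \<P>" "finite A"
  shows "card A = 2 * card \<P>"
  using assms card_partition[of \<P> 2]
  by (auto simp: is_pairing_def partition_on_def disjoint_def finite_UnionD)

text \<open>
  Each pair contributes at least one element with \<open>f z \<le> 1\<close>, since a product of two numbers
  above \<open>1\<close> is above \<open>1\<close>.
\<close>

lemma card_le_pairing:
  fixes f :: "'a \<Rightarrow> real"
  assumes pairing: "is_pairing A \<P>" and fin: "finite A"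
    and prod: "\<And>B x y. B \<in> \<P> \<Longrightarrow> x \<in> B \<Longrightarrow> y \<in> B \<Longrightarrow> x \<noteq> y \<Longrightarrow> f x * f y \<le> 1"
  shows "card A \<le> 2 * card {z \<in> A. f z \<le> 1}"
proof -
  have part: "partition_on A \<P>" and two: "\<And>B. B \<in> \<P> \<Longrightarrow> card B = 2"
    using pairing by (auto simp: is_pairing_def)
  have finP: "finite \<P>"
    using part fin by (simp add: partition_on_def finite_UnionD)
  have finB: "finite B" if "B \<in> \<P>" for B
    using two[OF that] by (simp add: card_ge_0_finite)
  have "card \<P> = (\<Sum>B\<in>\<P>. 1)"
    by simp
  also have "\<dots> \<le> (\<Sum>B\<in>\<P>. card {z \<in> B. f z \<le> 1})"
  proof (rule sum_mono)
    fix B assume B: "B \<in> \<P>"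
    obtain x y where xy: "B = {x, y}" "x \<noteq> y"
      using two[OF B] by (auto simp: card_2_iff)
    have "f x \<le> 1 \<or> f y \<le> 1"
      using prod[OF B, of x y] xy less_1_mult[of "f x" "f y"] by force
    then have "{z \<in> B. f z \<le> 1} \<noteq> {}"
      using xy by auto
    then show "1 \<le> card {z \<in> B. f z \<le> 1}"
      using finB[OF B] by (simp add: Suc_le_eq card_gt_0_iff)
  qed
  also have "\<dots> = card (\<Union>B\<in>\<P>. {z \<in> B. f z \<le> 1})"
    using finB finP part
    by (intro card_UN_disjoint[symmetric]) (auto simp: partition_on_def disjoint_def)
  also have "(\<Union>B\<in>\<P>. {z \<in> B. f z \<le> 1}) = {z \<in> A. f z \<le> 1}"
    using part by (auto simp: partition_on_def)
  finally show ?thesis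
    using card_is_pairing[OF pairing fin] by simp
qed

text \<open>
  The largest value is matched with the smallest. If their product exceeded \<open>1\<close>, some threshold
  \<open>t > 1\<close> would have the largest value above \<open>t\<close> but none up to \<open>1 / t\<close>. Removing the two elements keeps
  the tail condition: for \<open>t\<close> below the largest value the left-hand count loses one element and the
  right-hand count at most one, and for every other \<open>t\<close> the left-hand count is \<open>0\<close>.
\<close>

lemma pairing_of_tail_balance:
  fixes f :: "'a \<Rightarrow> real"
  assumes "finite A" "even (card A)" "\<And>x. x \<in> A \<Longrightarrow> 0 \<le> f x"
    and "\<And>t. 1 \<le> t \<Longrightarrow> card {x \<in> A. t < f x} \<le> card {x \<in> A. f x \<le> 1 / t}"
  shows "\<exists>\<P>. is_pairing A \<P> \<and> (\<forall>B\<in>\<P>. \<forall>x\<in>B. \<forall>y\<in>B. x \<noteq> y \<longrightarrow> f x * f y \<le> 1)"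
  using assms
proof (induction "card A" arbitrary: A rule: less_induct)
  case less
  note fin = less.prems(1) and nonneg = less.prems(3) and tail = less.prems(4)
  show ?case
  proof (cases "A = {}")
    case True
    then show ?thesis
      by (intro exI[of _ "{}"]) (auto simp: is_pairing_def partition_on_def)
  next
    case False
    obtain x where x: "x \<in> A" "\<And>z. z \<in> A \<Longrightarrow> f z \<le> f x"
    proof -
      have "Max (f ` A) \<in> f ` A"
        using fin False by simp
      then obtain x where "x \<in> A" "f x = Max (f ` A)"
        by auto
      then show thesis
        using fin that[of x] by simp
    qed
    have "A - {x} \<noteq> {}"
    proof
      assume "A - {x} = {}"
      then have "A = {x}"
        using x(1) by auto
      then show False
        using less.prems(2) by simp
    qed
    then obtain y where y: "y \<in> A - {x}" "\<And>z. z \<in> A - {x} \<Longrightarrow> f y \<le> f z"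
      using ex_is_arg_min_if_finite[of "A - {x}" f] fin unfolding is_arg_min_linorder by blast
    have ymin: "f y \<le> f z" if "z \<in> A" for z
      using that x(2)[of y] y by (cases "z = x") auto
    have xy: "f x * f y \<le> 1"
    proof (rule ccontr)
      assume gt: "\<not> f x * f y \<le> 1"
      have y0: "0 \<le> f y" "0 \<le> f x" "f y \<le> f x"
        using nonneg x y by auto
      have fy: "0 < f y"
        using gt y0 by (cases "f y = 0") auto
      have "1 < f x"
      proof (rule ccontr)
        assume "\<not> 1 < f x"
        then have "f x * f y \<le> 1"
          using y0 by (intro mult_le_one) auto
        then show False using gt by simp
      qed
      moreover have "1 / f y < f x"
        using gt fy by (simp add: field_simps)
      ultimately obtain t where t: "max 1 (1 / f y) < t" "t < f x"
        using dense[of "max 1 (1 / f y)" "f x"] by auto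
      have "{z \<in> A. f z \<le> 1 / t} = {}"
      proof -
        have "1 / t < f y"
          using t fy by (simp add: field_simps)
        then show ?thesis
          using ymin by force
      qed
      then have "card {z \<in> A. t < f z} = 0"
        using tail[of t] t by (metis card.empty le_zero_eq less_eq_real_def max_less_iff_conj)
      then show False
        using x(1) t fin by auto
    qed
    let ?A = "A - {x, y}"
    have "card A = card ?A + 2"
    proof -
      have "card {x, y} \<le> card A" "card {x, y} = 2"
        using x y fin by (auto intro!: card_mono)
      then show ?thesis
        using card_Diff_subset[of "{x, y}" A] x y by simp
    qed
    moreover have "card {z \<in> ?A. t < f z} \<le> card {z \<in> ?A. f z \<le> 1 / t}" if t: "1 \<le> t" for t
    proof (cases "t < f x")
      case True
      \<comment> \<open>As \<open>f x > 1 \<ge> 1 / t\<close>, \<open>x\<close> is not among the small values and only \<open>y\<close> can be lost there.\<close>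
      have notx: "\<not> f x \<le> 1 / t"
        using True t by (smt (verit) divide_le_eq_1)
      have "card {z \<in> ?A. t < f z} \<le> card ({z \<in> A. t < f z} - {x})"
        using fin by (intro card_mono) auto
      also have "\<dots> = card {z \<in> A. t < f z} - 1"
        using x True by (simp add: card_Diff_singleton)
      also have "\<dots> \<le> card {z \<in> A. f z \<le> 1 / t} - 1"
        using tail[OF t] by simp
      also have "\<dots> \<le> card ({z \<in> A. f z \<le> 1 / t} - {y})"
        using diff_card_le_card_Diff[of "{y}" "{z \<in> A. f z \<le> 1 / t}"] by simp
      also have "{z \<in> A. f z \<le> 1 / t} - {y} = {z \<in> ?A. f z \<le> 1 / t}"
        using notx by auto
      finally show ?thesis .
    next
      case False
      then have "{z \<in> ?A. t < f z} = {}"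
        using x(2) by force
      then show ?thesis by (simp only: card.empty)
    qed
    ultimately obtain \<P> where "is_pairing ?A \<P>"
        "\<forall>B\<in>\<P>. \<forall>x\<in>B. \<forall>y\<in>B. x \<noteq> y \<longrightarrow> f x * f y \<le> 1"
      using less.hyps[of ?A] fin nonneg less.prems(2) by auto
    then show ?thesis
      using is_pairing_insert[of A x y \<P>] x y xy
      by (intro exI[of _ "insert {x, y} \<P>"]) (auto simp: mult.commute)
  qed
qed

section \<open>Counting sign vectors\<close>

lemma finite_sign_vectors: "finite (sign_vectors n)"
  by (simp add: sign_vectors_def finite_PiE)

lemma sign_pmf_uniform: "sign_pmf n = pmf_of_set (sign_vectors n)"
proof -
  have "PiE_dflt {1..n} undefined (\<lambda>_. {- 1, 1 :: real}) = sign_vectors n"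
    by (auto simp: PiE_dflt_def sign_vectors_def PiE_def Pi_def extensional_def)
  then show ?thesis
    by (simp add: sign_pmf_def Pi_pmf_of_set)
qed

lemma prob_sign_pmf_ge_half_iff:
  "1 / 2 \<le> measure_pmf.prob (sign_pmf n) {e. Q e}
     \<longleftrightarrow> 2 ^ n \<le> 2 * card {e \<in> sign_vectors n. Q e}"
proof -
  have "sign_vectors n \<noteq> {}"
    using card_sign_vectors[of n] by auto
  then have "measure_pmf.prob (sign_pmf n) {e. Q e} = card {e \<in> sign_vectors n. Q e} / 2 ^ n"
    by (simp add: sign_pmf_uniform measure_pmf_of_set finite_sign_vectors card_sign_vectors
        Collect_conj_eq Int_commute)
  then have "1 / 2 \<le> measure_pmf.prob (sign_pmf n) {e. Q e}
      \<longleftrightarrow> 1 / 2 \<le> card {e \<in> sign_vectors n. Q e} / 2 ^ n"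
    by (simp only:)
  also have "\<dots> \<longleftrightarrow> real (2 ^ n) \<le> real (2 * card {e \<in> sign_vectors n. Q e})"
    by (simp add: field_simps)
  finally show ?thesis
    by (simp only: of_nat_le_iff)
qed

text \<open>
  The two terms on the right-hand side belong to the two values of the last sign.
\<close>

lemma card_sign_vectors_Suc:
  "card {e \<in> sign_vectors (Suc n). \<bar>dotn (Suc n) (a(Suc n := b)) e\<bar> \<le> c}
     = card {e \<in> sign_vectors n. \<bar>dotn n a e + b\<bar> \<le> c}
       + card {e \<in> sign_vectors n. \<bar>dotn n a e - b\<bar> \<le> c}"
proof -
  let ?ext = "\<lambda>s e. e(Suc n := s :: real)"
  let ?P = "{e \<in> sign_vectors n. \<bar>dotn n a e + b\<bar> \<le> c}"
  let ?M = "{e \<in> sign_vectors n. \<bar>dotn n a e - b\<bar> \<le> c}"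
  have split: "sign_vectors (Suc n) = ?ext 1 ` sign_vectors n \<union> ?ext (- 1) ` sign_vectors n"
    unfolding sign_vectors_def by (auto simp: atLeastAtMostSuc_conv PiE_insert_eq)
  have dotn_ext: "dotn (Suc n) (a(Suc n := b)) (?ext s e) = dotn n a e + b * s" for s e
    by (simp add: dotn_def)
  have inj: "inj_on (?ext s) (sign_vectors n)" for s
  proof (rule inj_onI)
    fix e e' assume e: "e \<in> sign_vectors n" "e' \<in> sign_vectors n" "?ext s e = ?ext s e'"
    have "e (Suc n) = e' (Suc n)"
      using e(1,2) by (simp add: sign_vectors_def PiE_def extensional_def)
    then show "e = e'"
      using e(3) by (metis fun_upd_idem_iff fun_upd_upd)
  qed
  have "{e \<in> sign_vectors (Suc n). \<bar>dotn (Suc n) (a(Suc n := b)) e\<bar> \<le> c}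
      = ?ext 1 ` ?P \<union> ?ext (- 1) ` ?M"
    unfolding split by (auto simp: dotn_ext)
  moreover have "?ext 1 ` ?P \<inter> ?ext (- 1) ` ?M = {}"
    by (auto dest!: fun_cong[where x = "Suc n"])
  ultimately show ?thesis
    using inj_on_subset[OF inj] finite_sign_vectors
    by (simp add: card_Un_disjoint card_image)
qed

section \<open>From the half bound to the tail condition\<close>

text \<open>
  Here \<open>b\<close> is chosen so that the extended vector has norm \<open>c\<close> with \<open>c + b = t\<close> and
  \<open>c - b = 1 / t\<close>. The sign vectors with \<open>S e \<in> [- t, 1 / t]\<close> and those with \<open>S e \<in> [- 1 / t, t]\<close>
  are counted together by inclusion and exclusion, where \<open>S e\<close> is \<open>dotn n a e\<close>.
\<close>

lemma tail_balance_of_half: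
  assumes norm: "L2_set a {1..n} = 1" and t: "1 \<le> t"
    and half: "\<And>a :: nat \<Rightarrow> real. 1 / 2 \<le>
      measure_pmf.prob (sign_pmf (Suc n)) {e. \<bar>dotn (Suc n) a e\<bar> \<le> L2_set a {1..Suc n}}"
  shows "card {e \<in> sign_vectors n. t < \<bar>dotn n a e\<bar>}
    \<le> card {e \<in> sign_vectors n. \<bar>dotn n a e\<bar> \<le> 1 / t}"
proof -
  define b c where "b = (t - 1 / t) / 2" and "c = (t + 1 / t) / 2"
  have bc: "c + b = t" "c - b = 1 / t"
    by (simp_all add: b_def c_def field_simps)
  have inv: "0 < 1 / t" "1 / t \<le> t"
  proof -
    show "0 < 1 / t" using t by simp
    have "1 / t \<le> 1" using t by simp
    then show "1 / t \<le> t" using t by linarith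
  qed
  have "(c + b) * (c - b) = 1"
    using bc t by simp
  then have "1 + b\<^sup>2 = c\<^sup>2"
    by (simp add: algebra_simps power2_eq_square)
  moreover have "0 \<le> c"
    using inv t by (simp add: c_def)
  moreover have "(\<Sum>i = 1..n. (a i)\<^sup>2) = 1"
    using norm by (simp add: L2_set_def)
  ultimately have L2: "L2_set (a(Suc n := b)) {1..Suc n} = c"
    by (simp add: L2_set_def)
  let ?P = "{e \<in> sign_vectors n. \<bar>dotn n a e + b\<bar> \<le> c}"
  let ?M = "{e \<in> sign_vectors n. \<bar>dotn n a e - b\<bar> \<le> c}"
  let ?L = "{e \<in> sign_vectors n. \<bar>dotn n a e\<bar> \<le> t}"
  let ?S = "{e \<in> sign_vectors n. \<bar>dotn n a e\<bar> \<le> 1 / t}"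
  let ?U = "{e \<in> sign_vectors n. t < \<bar>dotn n a e\<bar>}"
  have fin: "finite {e \<in> sign_vectors n. Q e}" for Q
    using finite_sign_vectors by simp
  have "\<bar>s + b\<bar> \<le> c \<or> \<bar>s - b\<bar> \<le> c \<longleftrightarrow> \<bar>s\<bar> \<le> t" for s
    using bc inv by linarith
  then have un: "?P \<union> ?M = ?L"
    by blast
  have "\<bar>s + b\<bar> \<le> c \<and> \<bar>s - b\<bar> \<le> c \<longleftrightarrow> \<bar>s\<bar> \<le> 1 / t" for s
    using bc inv by linarith
  then have int: "?P \<inter> ?M = ?S"
    by blast
  have "2 ^ Suc n \<le> 2 * (card ?P + card ?M)"
    using half[of "a(Suc n := b)"]
    by (simp only: prob_sign_pmf_ge_half_iff L2 card_sign_vectors_Suc)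
  also have "card ?P + card ?M = card ?L + card ?S"
    using card_Un_Int[OF fin fin, of "\<lambda>e. \<bar>dotn n a e + b\<bar> \<le> c" "\<lambda>e. \<bar>dotn n a e - b\<bar> \<le> c"]
    by (simp only: un int)
  finally have "2 ^ n \<le> card ?L + card ?S"
    by simp
  moreover have "card ?L + card ?U = 2 ^ n"
  proof -
    have "?L \<union> ?U = sign_vectors n" "?L \<inter> ?U = {}"
      by auto
    then show ?thesis
      using card_Un_disjoint[OF fin fin, of "\<lambda>e. \<bar>dotn n a e\<bar> \<le> t" "\<lambda>e. t < \<bar>dotn n a e\<bar>"]
      by (simp only: card_sign_vectors)
  qed
  ultimately show ?thesis
    by linarith
qed

section \<open>The equivalence\<close>

theorem theorem2p6:
  shows "(\<forall>n\<ge>1. \<forall>a :: nat \<Rightarrow> real.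
            measure_pmf.prob (sign_pmf n) {e. \<bar>dotn n a e\<bar> \<le> L2_set a {1..n}} \<ge> 1 / 2)
     \<longleftrightarrow> (\<forall>n\<ge>1. \<forall>a :: nat \<Rightarrow> real. L2_set a {1..n} = 1 \<longrightarrow>
            (\<exists>\<P>. is_pairing (sign_vectors n) \<P> \<and> card \<P> = 2 ^ (n - 1) \<and>
                 (\<forall>B\<in>\<P>. \<forall>e\<in>B. \<forall>e'\<in>B. e \<noteq> e' \<longrightarrow> \<bar>dotn n a e\<bar> * \<bar>dotn n a e'\<bar> \<le> 1)))"
    (is "?half \<longleftrightarrow> ?pairings")
proof
  assume half: ?half
  show ?pairings
  proof (intro allI impI)
    fix n :: nat and a :: "nat \<Rightarrow> real"
    assume n: "1 \<le> n" and norm: "L2_set a {1..n} = 1"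
    obtain m where m: "n = Suc m"
      using n by (cases n) auto
    have card: "card (sign_vectors n) = 2 * 2 ^ m"
      by (simp add: card_sign_vectors m)
    have "\<exists>\<P>. is_pairing (sign_vectors n) \<P> \<and>
        (\<forall>B\<in>\<P>. \<forall>e\<in>B. \<forall>e'\<in>B. e \<noteq> e' \<longrightarrow> \<bar>dotn n a e\<bar> * \<bar>dotn n a e'\<bar> \<le> 1)"
    proof (rule pairing_of_tail_balance)
      fix t :: real
      assume "1 \<le> t"
      then show "card {e \<in> sign_vectors n. t < \<bar>dotn n a e\<bar>}
          \<le> card {e \<in> sign_vectors n. \<bar>dotn n a e\<bar> \<le> 1 / t}"
        using half by (intro tail_balance_of_half norm) auto
    qed (simp_all add: finite_sign_vectors card)
    moreover have "card \<P> = 2 ^ (n - 1)" if "is_pairing (sign_vectors n) \<P>" for \<P>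
      using card_is_pairing[OF that finite_sign_vectors] card m by simp
    ultimately show "\<exists>\<P>. is_pairing (sign_vectors n) \<P> \<and> card \<P> = 2 ^ (n - 1) \<and>
        (\<forall>B\<in>\<P>. \<forall>e\<in>B. \<forall>e'\<in>B. e \<noteq> e' \<longrightarrow> \<bar>dotn n a e\<bar> * \<bar>dotn n a e'\<bar> \<le> 1)"
      by blast
  qed
next
  assume pairings: ?pairings
  show ?half
  proof (intro allI impI)
    fix n :: nat and a :: "nat \<Rightarrow> real"
    assume n: "1 \<le> n"
    define r where "r = L2_set a {1..n}"
    show "1 / 2 \<le> measure_pmf.prob (sign_pmf n) {e. \<bar>dotn n a e\<bar> \<le> L2_set a {1..n}}"
    proof (cases "r = 0")
      \<comment> \<open>The zero vector cannot be normalised, but all of its sign sums vanish.\<close>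
      case True
      then have "dotn n a e = 0" for e
        by (simp add: r_def L2_set_eq_0_iff dotn_def)
      then show ?thesis
        by (simp add: L2_set_nonneg)
    next
      case False
      then have r: "0 < r"
        using L2_set_nonneg[of a "{1..n}"] unfolding r_def by linarith
      let ?u = "\<lambda>i. a i / r"
      have "L2_set ?u {1..n} = 1"
        using L2_set_left_distrib[of "1 / r" a "{1..n}"] r by (simp add: r_def)
      then obtain \<P> where "is_pairing (sign_vectors n) \<P>"
        "\<forall>B\<in>\<P>. \<forall>e\<in>B. \<forall>e'\<in>B. e \<noteq> e' \<longrightarrow> \<bar>dotn n ?u e\<bar> * \<bar>dotn n ?u e'\<bar> \<le> 1"
        using pairings n by blast
      then have "2 ^ n \<le> 2 * card {e \<in> sign_vectors n. \<bar>dotn n ?u e\<bar> \<le> 1}"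
        using card_le_pairing[of "sign_vectors n" \<P> "\<lambda>e. \<bar>dotn n ?u e\<bar>"]
        by (simp add: finite_sign_vectors card_sign_vectors)
      moreover have "\<bar>dotn n ?u e\<bar> \<le> 1 \<longleftrightarrow> \<bar>dotn n a e\<bar> \<le> r" for e
      proof -
        have "dotn n ?u e = dotn n a e / r"
          by (simp add: dotn_def sum_divide_distrib)
        then show ?thesis
          using r by (simp add: abs_divide)
      qed
      ultimately show ?thesis
        unfolding prob_sign_pmf_ge_half_iff by (simp add: r_def)
    qed
  qed
qed

end
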